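(* $m(K_{d,d})=2^{d}$ for every integer $d\ge 4$.
   Context: Let $H=(V,E)$ be a finite simple graph. A spanning subgraph of $H$ is identified with its edge set $A\subseteq E$ (its vertex set is all of $V$); it is called connected and spanning if the graph $(V,A)$ is connected. A family $\mathcal{C}\subseteq 2^{E}$ is a connectivity code for $H$ if for all distinct $A,B\in\mathcal{C}$ the symmetric difference $A\triangle B$ is a connected spanning subgraph of $H$. The maximum cardinality of a connectivity code for $H$ is denoted $m(H)$. $K_{d,d}$ is the complete bipartite graph with $d$ vertices on each side. *)

theory Defs
  imports Main
begin

text \<open>A graph is a pair \<open>(V, E)\<close> of a vertex set and a set of edges, each edge being an
  unordered pair of distinct vertices.\<close>

type_synonym 'a graph = "'a set \<times> 'a set set"

definition finite_simple_graph :: "'a graph \<Rightarrow> bool" where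
  "finite_simple_graph H \<longleftrightarrow>
     finite (fst H) \<and> (\<forall>e\<in>snd H. \<exists>u\<in>fst H. \<exists>v\<in>fst H. u \<noteq> v \<and> e = {u, v})"

definition connected_graph :: "'a graph \<Rightarrow> bool" where
  "connected_graph H \<longleftrightarrow>
     fst H \<noteq> {} \<and> (\<forall>u\<in>fst H. \<forall>v\<in>fst H. (u, v) \<in> {(x, y). {x, y} \<in> snd H}\<^sup>*)"

definition connected_spanning :: "'a graph \<Rightarrow> 'a set set \<Rightarrow> bool" where
  "connected_spanning H A \<longleftrightarrow> A \<subseteq> snd H \<and> connected_graph (fst H, A)"

definition connectivity_code :: "'a graph \<Rightarrow> 'a set set set \<Rightarrow> bool" where
  "connectivity_code H C \<longleftrightarrow>
     C \<subseteq> Pow (snd H) \<and>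
     (\<forall>A\<in>C. \<forall>B\<in>C. A \<noteq> B \<longrightarrow> connected_spanning H ((A - B) \<union> (B - A)))"

definition max_code_size :: "'a graph \<Rightarrow> nat" where
  "max_code_size H = Max {card C |C. connectivity_code H C}"

definition complete_bipartite :: "nat \<Rightarrow> nat \<Rightarrow> (nat + nat) graph" where
  "complete_bipartite m n =
     ({..<m} <+> {..<n}, {{Inl i, Inr j} |i j. i < m \<and> j < n})"

lemma finite_simple_graph_complete_bipartite:
  "finite_simple_graph (complete_bipartite m n)"
  unfolding finite_simple_graph_def complete_bipartite_def by fastforce

text \<open>For a finite simple graph, the maximum in \<open>max_code_size\<close> is taken over a finite nonempty
  set of cardinalities of finite families, so it is attained and bounds every code.\<close>

lemma finite_edges:
  assumes "finite_simple_graph H"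
  shows "finite (snd H)"
proof (rule finite_subset)
  show "snd H \<subseteq> Pow (fst H)"
    using assms unfolding finite_simple_graph_def by fastforce
  show "finite (Pow (fst H))"
    using assms unfolding finite_simple_graph_def by simp
qed

lemma connectivity_code_finite:
  assumes "finite_simple_graph H" "connectivity_code H C"
  shows "finite C"
  using assms finite_edges[of H] unfolding connectivity_code_def
  by (meson finite_Pow_iff finite_subset)

lemma finite_code_sizes:
  assumes "finite_simple_graph H"
  shows "finite {card C |C. connectivity_code H C}"
proof (rule finite_subset)
  show "{card C |C. connectivity_code H C} \<subseteq> card ` Pow (Pow (snd H))"
    unfolding connectivity_code_def by blast
  show "finite (card ` Pow (Pow (snd H)))"
    using finite_edges[OF assms] by simp
qed

lemma connectivity_code_empty: "connectivity_code H {}"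
  unfolding connectivity_code_def by simp

lemma max_code_size_attained:
  assumes "finite_simple_graph H"
  shows "\<exists>C. connectivity_code H C \<and> card C = max_code_size H"
proof -
  have "max_code_size H \<in> {card C |C. connectivity_code H C}"
    unfolding max_code_size_def
    using finite_code_sizes[OF assms] connectivity_code_empty by (intro Max_in) blast+
  then show ?thesis by auto
qed

lemma card_le_max_code_size:
  assumes "finite_simple_graph H" "connectivity_code H C"
  shows "card C \<le> max_code_size H"
  unfolding max_code_size_def
  using finite_code_sizes[OF assms(1)] assms(2) by (intro Max_ge) blast+

end

theory Submission
  imports Defs
begin

text \<open>Two codewords agreeing on all edges at one vertex have a difference isolating that vertex, so
  restricting to its \<open>d\<close> edges is injective and a code has at most \<open>2 ^ d\<close> members.

  For the converse we build a linear code, i.e. a matrix \<open>M x\<close> over the two-element field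
  depending additively on \<open>x\<close> in its \<open>d\<close>-th power, such that \<open>M x\<close> is the
  biadjacency matrix of a connected graph whenever \<open>x \<noteq> 0\<close>. For \<open>d = 4\<close> four explicit
  matrices span such a code. To pass from \<open>d\<close> to \<open>d + 1\<close>, border \<open>M x\<close> by the row
  \<open>x + (t, \<dots>, t)\<close>, the column \<open>u x + (t, \<dots>, t)\<close> and the corner \<open>t\<close>,
  where \<open>t\<close> is the new coordinate and \<open>u\<close> is a linear bijection not fixing the all-ones
  vector. If \<open>x \<noteq> 0\<close>, the block is connected, and the new row and column are both attached to
  it directly when \<open>t = 0\<close>; when \<open>t = 1\<close> they are adjacent through the corner, and at least
  one of them is attached because \<open>x\<close> and \<open>u x\<close> are not both all-ones. If \<open>x = 0\<close>
  and \<open>t = 1\<close>, the new row and column are full.\<close>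

section \<open>Biadjacency matrices and connectedness\<close>

definition bip_edges :: "nat \<Rightarrow> (nat \<Rightarrow> nat \<Rightarrow> bool) \<Rightarrow> (nat + nat) set set" where
  "bip_edges d P = {{Inl i, Inr j} |i j. i < d \<and> j < d \<and> P i j}"

text \<open>Connectedness is phrased by colourings instead of paths: a concrete instance is then a
  propositional formula, and bordering a matrix only requires extending a constant colouring.\<close>

definition bip_connected :: "nat \<Rightarrow> (nat \<Rightarrow> nat \<Rightarrow> bool) \<Rightarrow> bool" where
  "bip_connected d P \<longleftrightarrow>
     (\<forall>f g :: nat \<Rightarrow> bool. (\<forall>i<d. \<forall>j<d. P i j \<longrightarrow> f i = g j)
        \<longrightarrow> (\<exists>c. \<forall>i<d. f i = c \<and> g i = c))"

text \<open>A set stands for the 0/1 vector of its members and \<open>sym_diff\<close> for addition.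
  Sets need not lie below \<open>d\<close>, so bordering can apply \<open>M\<close> to a set
  containing the new coordinate.\<close>

definition linear_code :: "nat \<Rightarrow> (nat set \<Rightarrow> nat \<Rightarrow> nat \<Rightarrow> bool) \<Rightarrow> bool" where
  "linear_code d M \<longleftrightarrow>
     (\<forall>x y i j. M (sym_diff x y) i j \<longleftrightarrow> M x i j \<noteq> M y i j) \<and>
     (\<forall>x. x \<inter> {..<d} \<noteq> {} \<longrightarrow> bip_connected d (M x))"

lemma bip_connectedD:
  fixes f g :: "nat \<Rightarrow> bool"
  assumes "bip_connected d P" "\<And>i j. i < d \<Longrightarrow> j < d \<Longrightarrow> P i j \<Longrightarrow> f i = g j"
  shows "\<exists>c. \<forall>i<d. f i = c \<and> g i = c"
  using assms unfolding bip_connected_def by simp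

lemma linear_code_add: "linear_code d M \<Longrightarrow> M (sym_diff x y) i j \<longleftrightarrow> M x i j \<noteq> M y i j"
  by (simp add: linear_code_def)

lemma linear_code_connected: "linear_code d M \<Longrightarrow> x \<inter> {..<d} \<noteq> {} \<Longrightarrow> bip_connected d (M x)"
  by (simp add: linear_code_def)

lemma mem_bip_edges [simp]:
  "{Inl i, Inr j} \<in> bip_edges d P \<longleftrightarrow> i < d \<and> j < d \<and> P i j"
  by (auto simp: bip_edges_def doubleton_eq_iff)

lemma sym_diff_bip_edges:
  "sym_diff (bip_edges d P) (bip_edges d Q) = bip_edges d (\<lambda>i j. P i j \<noteq> Q i j)"
  (is "?L = ?R")
proof (rule set_eqI)
  fix e
  show "e \<in> ?L \<longleftrightarrow> e \<in> ?R"
  proof (cases "\<exists>i j. e = {Inl i, Inr j}")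
    case True
    then show ?thesis by auto
  next
    case False
    then show ?thesis unfolding bip_edges_def by blast
  qed
qed

lemma snd_complete_bipartite: "snd (complete_bipartite d d) = bip_edges d (\<lambda>_ _. True)"
  by (simp add: complete_bipartite_def bip_edges_def)

lemma connected_spanning_bip_edges:
  assumes "bip_connected d P" "d > 0"
  shows "connected_spanning (complete_bipartite d d) (bip_edges d P)"
proof -
  let ?V = "{..<d} <+> {..<d} :: (nat + nat) set"
  let ?R = "{(x, y). {x, y} \<in> bip_edges d P}"
  have "(u, v) \<in> ?R\<^sup>*" if u: "u \<in> ?V" and v: "v \<in> ?V" for u v
  proof -
    \<comment> \<open>Colour each vertex by reachability from \<open>u\<close>: adjacent vertices
      agree, so the colouring is constant, and it is true at \<open>u\<close>.\<close>
    let ?f = "\<lambda>i. (u, Inl i) \<in> ?R\<^sup>*" and ?g = "\<lambda>j. (u, Inr j) \<in> ?R\<^sup>*"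
    have edge: "?f i = ?g j" if "i < d" "j < d" "P i j" for i j
    proof -
      have "(Inl i, Inr j) \<in> ?R" "(Inr j, Inl i) \<in> ?R"
        using that by (simp_all add: insert_commute)
      then show ?thesis by (meson rtrancl.rtrancl_into_rtrancl)
    qed
    obtain c where c: "\<forall>i<d. ?f i = c \<and> ?g i = c"
      using bip_connectedD[of d P ?f ?g, OF assms(1) edge] by blast
    moreover have "(u, u) \<in> ?R\<^sup>*" by blast
    ultimately have "c" using u by (auto simp del: rtrancl.rtrancl_refl)
    then show ?thesis using c v by auto
  qed
  moreover have "?V \<noteq> {}" using assms(2) by auto
  moreover have "bip_edges d P \<subseteq> bip_edges d (\<lambda>_ _. True)" by (auto simp: bip_edges_def)
  ultimately show ?thesis
    unfolding connected_spanning_def connected_graph_def snd_complete_bipartite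
    by (simp add: complete_bipartite_def)
qed

section \<open>Upper bound from the edges at one vertex\<close>

lemma connected_graph_incident:
  assumes "connected_graph (V, A)" "u \<in> V" "v \<in> V" "u \<noteq> v"
  shows "\<exists>e\<in>A. u \<in> e"
proof -
  have "(u, v) \<in> {(x, y). {x, y} \<in> A}\<^sup>*"
    using assms unfolding connected_graph_def by simp
  then show ?thesis using assms(4) by (cases rule: converse_rtranclE) auto
qed

lemma card_code_le_star:
  assumes H: "finite_simple_graph H" and C: "connectivity_code H C"
    and uv: "u \<in> fst H" "v \<in> fst H" "u \<noteq> v"
  shows "card C \<le> 2 ^ card {e \<in> snd H. u \<in> e}"
proof -
  let ?S = "{e \<in> snd H. u \<in> e}"
  have fin: "finite ?S" using finite_edges[OF H] by simp
  have "inj_on (\<lambda>A. A \<inter> ?S) C"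
  proof (rule inj_onI, rule ccontr)
    fix A B
    assume AB: "A \<in> C" "B \<in> C" "A \<inter> ?S = B \<inter> ?S" "A \<noteq> B"
    then have "connected_graph (fst H, sym_diff A B)"
      using C unfolding connectivity_code_def connected_spanning_def by blast
    then obtain e where "e \<in> sym_diff A B" "u \<in> e"
      using connected_graph_incident uv by metis
    moreover have "A \<subseteq> snd H" "B \<subseteq> snd H"
      using C AB(1,2) unfolding connectivity_code_def by auto
    ultimately show False using AB(3) by blast
  qed
  then have "card C \<le> card (Pow ?S)"
    using fin by (intro card_inj_on_le) auto
  then show ?thesis using fin by (simp add: card_Pow)
qed

lemma card_code_complete_bipartite_le:
  assumes "connectivity_code (complete_bipartite d d) C" "d > 0"
  shows "card C \<le> 2 ^ d"
proof -
  let ?H = "complete_bipartite d d"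
  have "{e \<in> snd ?H. Inl 0 \<in> e} = (\<lambda>j. {Inl 0, Inr j}) ` {..<d}"
    using assms(2) by (auto simp: snd_complete_bipartite bip_edges_def)
  moreover have "inj_on (\<lambda>j :: nat. {Inl 0 :: nat + nat, Inr j}) {..<d}"
    by (auto simp: inj_on_def doubleton_eq_iff)
  ultimately have "card {e \<in> snd ?H. Inl 0 \<in> e} = d"
    by (simp add: card_image)
  moreover have "Inl 0 \<in> fst ?H" "Inr 0 \<in> fst ?H"
    using assms(2) by (auto simp: complete_bipartite_def)
  ultimately show ?thesis
    using card_code_le_star[OF finite_simple_graph_complete_bipartite assms(1), of "Inl 0" "Inr 0"]
    by simp
qed

section \<open>Linear codes for all \<open>d \<ge> 4\<close>\<close>

text \<open>These four matrices were found by a computer search.\<close>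

definition base_rows :: "nat \<Rightarrow> nat list list" where
  "base_rows k =
     [[[1,1,1,0], [0,1,0,1], [0,0,1,1], [0,0,0,1]],
      [[0,1,0,0], [1,1,1,0], [1,1,0,1], [1,0,1,1]],
      [[0,1,0,1], [1,0,0,1], [0,1,1,0], [0,0,1,1]],
      [[0,0,1,1], [1,1,1,1], [1,0,0,1], [0,1,1,1]]] ! k"

definition base_code :: "nat set \<Rightarrow> nat \<Rightarrow> nat \<Rightarrow> bool" where
  "base_code x i j \<longleftrightarrow>
     (((0 \<in> x \<and> base_rows 0 ! i ! j = 1) \<noteq> (1 \<in> x \<and> base_rows 1 ! i ! j = 1)) \<noteq>
      ((2 \<in> x \<and> base_rows 2 ! i ! j = 1) \<noteq> (3 \<in> x \<and> base_rows 3 ! i ! j = 1)))"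

lemma all_less_4: "(\<forall>i<4. P i) \<longleftrightarrow> P 0 \<and> P 1 \<and> P 2 \<and> P (3::nat)"
  by (auto simp: numeral_eq_Suc less_Suc_eq)

lemma linear_code_base: "linear_code 4 base_code"
proof -
  have "bip_connected 4 (base_code x)" if "x \<inter> {..<4} \<noteq> {}" for x
  proof -
    have nonempty: "0 \<in> x \<or> 1 \<in> x \<or> 2 \<in> x \<or> 3 \<in> x"
      using that all_less_4[of "\<lambda>i. i \<notin> x"] by auto
    show ?thesis
      unfolding bip_connected_def
    proof (intro allI impI)
      fix f g :: "nat \<Rightarrow> bool"
      assume edges: "\<forall>i<4. \<forall>j<4. base_code x i j \<longrightarrow> f i = g j"
      \<comment> \<open>Fixing the membership of 0, 1, 2, 3 in \<open>x\<close> leaves fifteen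
        concrete nonzero matrices, whose entries force all eight colours to agree.\<close>
      have "f 1 = f 0 \<and> f 2 = f 0 \<and> f 3 = f 0 \<and>
          g 0 = f 0 \<and> g 1 = f 0 \<and> g 2 = f 0 \<and> g 3 = f 0"
        using nonempty
        by (cases "0 \<in> x"; cases "1 \<in> x"; cases "2 \<in> x"; cases "3 \<in> x";
            insert edges[unfolded all_less_4 base_code_def base_rows_def]; simp; argo)
      then show "\<exists>c. \<forall>i<4. f i = c \<and> g i = c"
        unfolding all_less_4 by blast
    qed
  qed
  moreover have "base_code (sym_diff x y) i j \<longleftrightarrow> base_code x i j \<noteq> base_code y i j" for x y i j
    unfolding base_code_def by auto
  ultimately show ?thesis unfolding linear_code_def by blast
qed

text \<open>The linear bijection \<open>u\<close> used here adds coordinate 0 to coordinate 1.\<close>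

definition border ::
  "nat \<Rightarrow> (nat set \<Rightarrow> nat \<Rightarrow> nat \<Rightarrow> bool) \<Rightarrow> nat set \<Rightarrow> nat \<Rightarrow> nat \<Rightarrow> bool" where
  "border d M x i j \<longleftrightarrow>
     (if i < d then
        if j < d then M x i j else ((i \<in> x) \<noteq> (i = 1 \<and> 0 \<in> x)) \<noteq> (d \<in> x)
      else
        if j < d then (j \<in> x) \<noteq> (d \<in> x) else d \<in> x)"

lemma linear_code_border:
  assumes M: "linear_code d M" and d: "d \<ge> 2"
  shows "linear_code (Suc d) (border d M)"
proof -
  have "bip_connected (Suc d) (border d M x)" if x: "x \<inter> {..<Suc d} \<noteq> {}" for x
    unfolding bip_connected_def
  proof (intro allI impI)
    fix f g :: "nat \<Rightarrow> bool"
    assume "\<forall>i<Suc d. \<forall>j<Suc d. border d M x i j \<longrightarrow> f i = g j"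
    then have fg: "border d M x i j \<Longrightarrow> i \<le> d \<Longrightarrow> j \<le> d \<Longrightarrow> f i = g j" for i j
      by (simp add: less_Suc_eq_le)
    have corner: "f d = g d" if "d \<in> x"
      using fg[of d d] that by (simp add: border_def)
    have row: "f d = g j" if "j < d" "(j \<in> x) \<noteq> (d \<in> x)" for j
      using fg[of d j] that by (simp add: border_def)
    have col: "f i = g d" if "i < d" "((i \<in> x) \<noteq> (i = 1 \<and> 0 \<in> x)) \<noteq> (d \<in> x)" for i
      using fg[of i d] that by (simp add: border_def)
    have "\<exists>c. (\<forall>i<d. f i = c \<and> g i = c) \<and> f d = c \<and> g d = c"
    proof (cases "x \<inter> {..<d} = {}")
      case True
      then have "d \<in> x" "\<forall>i<d. i \<notin> x" using x by (auto simp: less_Suc_eq)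
      then have "f i = g d \<and> g i = f d" if "i < d" for i
        using row[of i] col[of i] that d by auto
      then show ?thesis using corner \<open>d \<in> x\<close> by auto
    next
      case False
      have block: "f i = g j" if "i < d" "j < d" "M x i j" for i j
        using fg[of i j] that by (simp add: border_def)
      obtain c where c: "\<forall>i<d. f i = c \<and> g i = c"
        using bip_connectedD[of d "M x" f g, OF linear_code_connected[OF M False] block] by blast
      have "f d = c \<and> g d = c"
      proof (cases "d \<in> x")
        case True
        show ?thesis
        proof (cases "\<forall>j<d. j \<in> x")
          case True
          \<comment> \<open>For \<open>x\<close> all ones, \<open>u x\<close> vanishes at coordinate
            1, so with \<open>t = 1\<close> row 1 meets the new column, and the corner joins the new
            row.\<close>
          then show ?thesis using col[of 1] corner c d \<open>d \<in> x\<close> by auto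
        next
          case False
          then show ?thesis using row corner c \<open>d \<in> x\<close> by metis
        qed
      next
        case d': False
        obtain k where k: "k < d" "k \<in> x" using False by auto
        have "f d = c" using row[of k] k d' c by simp
        moreover have "g d = c"
        \<comment> \<open>\<open>u\<close> keeps coordinate 0 and fixes vectors vanishing there, so
          \<open>u x\<close> is nonzero at 0 or at \<open>k\<close>.\<close>
        proof (cases "0 \<in> x")
          case True
          then show ?thesis using col[of 0] d' c d by simp
        next
          case False
          then show ?thesis using col[of k] k d' c by simp
        qed
        ultimately show ?thesis ..
      qed
      then show ?thesis using c by blast
    qed
    then show "\<exists>c. \<forall>i<Suc d. f i = c \<and> g i = c"
      by (metis less_SucE)
  qed
  moreover have "border d M (sym_diff x y) i j \<longleftrightarrow> border d M x i j \<noteq> border d M y i j"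
    for x y i j
    unfolding border_def linear_code_add[OF M] by auto
  ultimately show ?thesis unfolding linear_code_def by blast
qed

lemma linear_code_exists: "d \<ge> 4 \<Longrightarrow> \<exists>M. linear_code d M"
proof (induction d rule: nat_induct_at_least)
  case base
  show ?case using linear_code_base by blast
next
  case (Suc d)
  then obtain M where "linear_code d M" by blast
  then have "linear_code (Suc d) (border d M)"
    using Suc.hyps by (intro linear_code_border) auto
  then show ?case by blast
qed

section \<open>From linear codes to connectivity codes\<close>

lemma connectivity_code_linear_code:
  assumes M: "linear_code d M" and d: "d > 0"
  defines "C \<equiv> (\<lambda>x. bip_edges d (M x)) ` Pow {..<d}"
  shows "connectivity_code (complete_bipartite d d) C" "card C = 2 ^ d"
proof -
  let ?H = "complete_bipartite d d"
  have diff: "connected_spanning ?H (sym_diff (bip_edges d (M x)) (bip_edges d (M y)))"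
    if "x \<subseteq> {..<d}" "y \<subseteq> {..<d}" "x \<noteq> y" for x y
  proof -
    have "sym_diff x y \<inter> {..<d} \<noteq> {}" using that by blast
    then have "bip_connected d (M (sym_diff x y))"
      by (rule linear_code_connected[OF M])
    moreover have "M (sym_diff x y) = (\<lambda>i j. M x i j \<noteq> M y i j)"
      by (intro ext) (rule linear_code_add[OF M])
    ultimately have "bip_connected d (\<lambda>i j. M x i j \<noteq> M y i j)"
      by simp
    then show ?thesis
      unfolding sym_diff_bip_edges using d by (rule connected_spanning_bip_edges)
  qed
  have "C \<subseteq> Pow (snd ?H)"
    unfolding C_def snd_complete_bipartite by (auto simp: bip_edges_def)
  moreover have "connected_spanning ?H (sym_diff A B)" if AB: "A \<in> C" "B \<in> C" "A \<noteq> B" for A B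
  proof -
    from AB obtain x y where "x \<subseteq> {..<d}" "A = bip_edges d (M x)"
        "y \<subseteq> {..<d}" "B = bip_edges d (M y)"
      by (auto simp: C_def)
    then show ?thesis using diff[of x y] AB(3) by auto
  qed
  ultimately show "connectivity_code ?H C"
    unfolding connectivity_code_def by blast
  \<comment> \<open>Distinct vectors cannot share a codeword: by \<open>diff\<close> the empty edge
    set would then be connected.\<close>
  have "\<not> connected_spanning ?H {}"
  proof
    assume "connected_spanning ?H {}"
    then have "connected_graph (fst ?H, {})" by (simp add: connected_spanning_def)
    moreover have "Inl 0 \<in> fst ?H" "Inr 0 \<in> fst ?H"
      using d by (auto simp: complete_bipartite_def)
    ultimately show False
      using connected_graph_incident[of "fst ?H" "{}" "Inl 0" "Inr 0"] by simp
  qed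
  then have "bip_edges d (M x) \<noteq> bip_edges d (M y)"
    if "x \<subseteq> {..<d}" "y \<subseteq> {..<d}" "x \<noteq> y" for x y
    using diff[OF that] by auto
  then have "inj_on (\<lambda>x. bip_edges d (M x)) (Pow {..<d})"
    by (intro inj_onI) blast
  then show "card C = 2 ^ d"
    unfolding C_def by (simp add: card_image card_Pow)
qed

theorem corollary1p4:
  fixes d :: nat
  assumes "d \<ge> 4"
  shows "max_code_size (complete_bipartite d d) = 2 ^ d"
proof (rule antisym)
  have d: "d > 0" using assms by simp
  note H = finite_simple_graph_complete_bipartite
  show "max_code_size (complete_bipartite d d) \<le> 2 ^ d"
    using max_code_size_attained[OF H] card_code_complete_bipartite_le[OF _ d] by metis
  obtain M where "linear_code d M" using linear_code_exists[OF assms] by blast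
  from connectivity_code_linear_code[OF this d] show "2 ^ d \<le> max_code_size (complete_bipartite d d)"
    using card_le_max_code_size[OF H] by metis
qed

end
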